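(* Let $C$ be the Cantor set and let $T:C\to C$ be a minimal homeomorphism. Then the topological full group $[[T]]$ is LEF (locally embeddable into finite groups).
   Context: A homeomorphism $T:C\to C$ is minimal if every $T$-orbit $\{T^n(x)\}_{n\in\mathbf Z}$ is dense in $C$. The topological full group $[[T]]$ is the group of homeomorphisms $S:C\to C$ for which $C$ can be partitioned into finitely many clopen sets $C=\bigcup_{i=1}^n A_i$ such that $S|_{A_i}=T^{n_i}|_{A_i}$ for some integers $n_i$. For a finite nonempty set $A$, $Map(A)$ is the set of all maps $A\to A$ with composition, and $d_H(\alpha,\beta)=\frac{|\{x\in A:\alpha(x)\neq\beta(x)\}|}{|A|}$. A group $\Gamma$ is LEF if for every finite $F\subset\Gamma$ and $\epsilon>0$ there exist a finite nonempty set $A$ and a map $\Theta:\Gamma\to Map(A)$ such that $\Theta(fg)=\Theta(f)\Theta(g)$ whenever $f,g,fg\in F$; $d_H(\Theta(f),1)>1-\epsilon$ whenever $1\ne f\in F$; and $\Theta(1)=1$. (Equivalently: for every finite $F\subset\Gamma$ there are a finite group $H$ and an injective map $\Theta:F\to H$ with $\Theta(fg)=\Theta(f)\Theta(g)$ whenever $f,g,fg\in F$.) *)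

theory Defs
  imports "HOL-Analysis.Analysis" "HOL-Algebra.Bij"
begin

definition cantor_space :: "'a topology \<Rightarrow> bool" where
  "cantor_space X \<longleftrightarrow>
     X homeomorphic_space product_topology (\<lambda>_::nat. discrete_topology (UNIV :: bool set)) UNIV"

text \<open>As in \<^const>\<open>BijGroup\<close>, self-maps of a set are represented extensionally, so that equality
  of group elements is equality of maps on the underlying space.\<close>

definition homeo_group :: "'a topology \<Rightarrow> ('a \<Rightarrow> 'a) monoid" where
  "homeo_group X =
     (BijGroup (topspace X)) \<lparr>carrier := {S \<in> Bij (topspace X). homeomorphic_map X X S}\<rparr>"

lemma subgroup_homeomorphisms:
  "subgroup {S \<in> Bij (topspace X). homeomorphic_map X X S} (BijGroup (topspace X))"
  (is "subgroup ?H ?G")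
proof (rule group.subgroupI[OF group_BijGroup])
  show "?H \<subseteq> carrier ?G"
    by (auto simp: BijGroup_def)
  have "homeomorphic_map X X (\<lambda>x\<in>topspace X. x)"
    using homeomorphic_map_eq[of X X id "\<lambda>x\<in>topspace X. x"] by simp
  then show "?H \<noteq> {}"
    using id_Bij by blast
next
  fix f assume f: "f \<in> ?H"
  then obtain g where g: "homeomorphic_maps X X f g"
    by (auto simp: homeomorphic_map_maps)
  have inv: "inv\<^bsub>?G\<^esub> f = (\<lambda>x\<in>topspace X. inv_into (topspace X) f x)"
    using f by (simp add: inv_BijGroup)
  have "inv_into (topspace X) f x = g x" if "x \<in> topspace X" for x
    using f g that
    by (intro inv_into_f_eq)
      (auto simp: homeomorphic_maps_def Bij_def bij_betw_def continuous_map_def)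
  moreover have "homeomorphic_map X X g"
    using g homeomorphic_maps_map by blast
  ultimately have "homeomorphic_map X X (\<lambda>x\<in>topspace X. inv_into (topspace X) f x)"
    using homeomorphic_map_eq[of X X g] by simp
  then show "inv\<^bsub>?G\<^esub> f \<in> ?H"
    using f inv by (auto intro: restrict_inv_into_Bij)
next
  fix f g assume fg: "f \<in> ?H" "g \<in> ?H"
  have "homeomorphic_map X X (f \<circ> g)"
    using fg homeomorphic_map_compose by blast
  then have "homeomorphic_map X X (compose (topspace X) f g)"
    using homeomorphic_map_eq[of X X "f \<circ> g"] by (simp add: compose_def)
  then show "f \<otimes>\<^bsub>?G\<^esub> g \<in> ?H"
    using fg by (simp add: BijGroup_def compose_Bij)
qed

lemma group_homeo_group: "group (homeo_group X)"
  unfolding homeo_group_def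
  by (rule group.subgroup_imp_group[OF group_BijGroup subgroup_homeomorphisms])

definition minimal_homeo :: "'a topology \<Rightarrow> ('a \<Rightarrow> 'a) \<Rightarrow> bool" where
  "minimal_homeo X T \<longleftrightarrow>
     T \<in> carrier (homeo_group X) \<and>
     (\<forall>x \<in> topspace X.
        X closure_of (range (\<lambda>n::int. (T [^]\<^bsub>homeo_group X\<^esub> n) x)) = topspace X)"

definition topological_full_group :: "'a topology \<Rightarrow> ('a \<Rightarrow> 'a) \<Rightarrow> ('a \<Rightarrow> 'a) monoid" where
  "topological_full_group X T =
     (homeo_group X) \<lparr>carrier := {S \<in> carrier (homeo_group X).
        \<exists>(n::nat) (A :: nat \<Rightarrow> 'a set) (k :: nat \<Rightarrow> int).
          (\<forall>i<n. openin X (A i) \<and> closedin X (A i)) \<and>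
          disjoint_family_on A {..<n} \<and>
          (\<Union>i<n. A i) = topspace X \<and>
          (\<forall>i<n. \<forall>x \<in> A i. S x = (T [^]\<^bsub>homeo_group X\<^esub> k i) x)}\<rparr>"

definition map_monoid :: "'b set \<Rightarrow> ('b \<Rightarrow> 'b) monoid" where
  "map_monoid A = \<lparr>carrier = A \<rightarrow>\<^sub>E A, mult = compose A, one = (\<lambda>x\<in>A. x)\<rparr>"

definition hamming_dist :: "'b set \<Rightarrow> ('b \<Rightarrow> 'b) \<Rightarrow> ('b \<Rightarrow> 'b) \<Rightarrow> real" where
  "hamming_dist A \<alpha> \<beta> = real (card {x \<in> A. \<alpha> x \<noteq> \<beta> x}) / real (card A)"

text \<open>Every finite set is in bijection with a set of natural numbers, so it is no restriction
  to let the finite set \<open>A\<close> range over subsets of \<^typ>\<open>nat\<close>.\<close>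

definition LEF_group :: "('g, 'm) monoid_scheme \<Rightarrow> bool" where
  "LEF_group G \<longleftrightarrow> group G \<and>
     (\<forall>F \<epsilon>. finite F \<and> F \<subseteq> carrier G \<and> (0::real) < \<epsilon> \<longrightarrow>
        (\<exists>(A :: nat set) \<Theta>. finite A \<and> A \<noteq> {} \<and>
           \<Theta> \<in> carrier G \<rightarrow> carrier (map_monoid A) \<and>
           (\<forall>f\<in>F. \<forall>g\<in>F. f \<otimes>\<^bsub>G\<^esub> g \<in> F \<longrightarrow>
              \<Theta> (f \<otimes>\<^bsub>G\<^esub> g) = \<Theta> f \<otimes>\<^bsub>map_monoid A\<^esub> \<Theta> g) \<and>
           (\<forall>f\<in>F. f \<noteq> \<one>\<^bsub>G\<^esub> \<longrightarrow> hamming_dist A (\<Theta> f) \<one>\<^bsub>map_monoid A\<^esub> > 1 - \<epsilon>) \<and>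
           \<Theta> \<one>\<^bsub>G\<^esub> = \<one>\<^bsub>map_monoid A\<^esub>))"

end

theory Submission
  imports Defs
begin

text \<open>Fix a point \<open>x\<close>. Since \<open>T\<close> is aperiodic, every \<open>f\<close> in the full group acts on the orbit of a
  point \<open>y\<close> through a map \<open>pos f y\<close> of the integers, \<open>f (T\<^sup>n y) = T\<^sup>m y\<close> with \<open>m = pos f y n\<close>,
  which has bounded displacement. For finitely many \<open>f\<close> and \<open>n \<in> {-R..R}\<close>, the displacement
  \<open>m - n\<close> is the same for all \<open>y\<close> in a neighbourhood \<open>V\<close> of \<open>x\<close>. By minimality there
  are \<open>N > R\<close> and \<open>y\<close> in the orbit of \<open>x\<close> with \<open>y\<close> and \<open>T\<^sup>N y\<close> both in \<open>V\<close>. Then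
  \<open>pos f y (n + N) = pos f y n + N\<close> for \<open>n \<in> {-R..R}\<close>, so that gluing the ends of \<open>{0..<N}\<close> turns the
  maps \<open>pos f y\<close> into self-maps of the integers modulo \<open>N\<close>, multiplicatively on the given
  finite set, and without trivialising any of its elements other than the identity.\<close>

section \<open>Criteria for LEF: free choice of the finite set, and amplification\<close>

text \<open>Conjugation by a bijection of \<open>A\<close> onto \<open>{..<card A}\<close> preserves
  composition and Hamming distance. Approximations may therefore live in any type; tuples and
  integers are used below.\<close>

lemma LEF_groupI_hamming:
  fixes G :: "('g, 'm) monoid_scheme"
  assumes "group G"
    and approx: "\<And>F \<epsilon>. finite F \<Longrightarrow> F \<subseteq> carrier G \<Longrightarrow> (0::real) < \<epsilon> \<Longrightarrow>
      \<exists>(A :: 'b set) \<Theta>. finite A \<and> A \<noteq> {} \<and> \<Theta> \<in> carrier G \<rightarrow> carrier (map_monoid A) \<and>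
        (\<forall>f\<in>F. \<forall>g\<in>F. f \<otimes>\<^bsub>G\<^esub> g \<in> F \<longrightarrow>
           \<Theta> (f \<otimes>\<^bsub>G\<^esub> g) = \<Theta> f \<otimes>\<^bsub>map_monoid A\<^esub> \<Theta> g) \<and>
        (\<forall>f\<in>F. f \<noteq> \<one>\<^bsub>G\<^esub> \<longrightarrow> hamming_dist A (\<Theta> f) \<one>\<^bsub>map_monoid A\<^esub> > 1 - \<epsilon>) \<and>
        \<Theta> \<one>\<^bsub>G\<^esub> = \<one>\<^bsub>map_monoid A\<^esub>"
  shows "LEF_group G"
  unfolding LEF_group_def
proof (intro conjI allI impI, fact, elim conjE)
  fix F :: "'g set" and \<epsilon> :: real
  assume F: "finite F" "F \<subseteq> carrier G" "0 < \<epsilon>"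
  obtain A :: "'b set" and \<Theta> where A: "finite A" "A \<noteq> {}"
    and \<Theta>: "\<Theta> \<in> carrier G \<rightarrow> carrier (map_monoid A)"
    and mult: "\<And>f g. f \<in> F \<Longrightarrow> g \<in> F \<Longrightarrow> f \<otimes>\<^bsub>G\<^esub> g \<in> F \<Longrightarrow>
           \<Theta> (f \<otimes>\<^bsub>G\<^esub> g) = \<Theta> f \<otimes>\<^bsub>map_monoid A\<^esub> \<Theta> g"
    and dist: "\<And>f. f \<in> F \<Longrightarrow> f \<noteq> \<one>\<^bsub>G\<^esub> \<Longrightarrow> hamming_dist A (\<Theta> f) \<one>\<^bsub>map_monoid A\<^esub> > 1 - \<epsilon>"
    and one: "\<Theta> \<one>\<^bsub>G\<^esub> = \<one>\<^bsub>map_monoid A\<^esub>"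
    using approx[OF F] by blast
  obtain h where h: "bij_betw h A {..<card A}"
    using ex_bij_betw_finite_nat[OF A(1)] by (auto simp: atLeast0LessThan)
  define B where "B = {..<card A}"
  define j where "j = inv_into A h"
  have jh: "j (h a) = a" "h a \<in> B" if "a \<in> A" for a
    using h that by (auto simp: j_def B_def bij_betw_def)
  have hj: "h (j b) = b" "j b \<in> A" if "b \<in> B" for b
    using h that by (auto simp: j_def B_def bij_betw_def f_inv_into_f inv_into_into)
  define \<Phi> where "\<Phi> f = (\<lambda>b\<in>B. h (\<Theta> f (j b)))" for f
  have \<Theta>_in: "\<Theta> f a \<in> A" if "f \<in> carrier G" "a \<in> A" for f a
    using \<Theta> that by (auto simp: map_monoid_def Pi_iff)
  have "\<Phi> \<in> carrier G \<rightarrow> carrier (map_monoid B)"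
    using \<Theta>_in jh hj by (auto simp: \<Phi>_def map_monoid_def)
  moreover have "\<Phi> (f \<otimes>\<^bsub>G\<^esub> g) = \<Phi> f \<otimes>\<^bsub>map_monoid B\<^esub> \<Phi> g"
    if "f \<in> F" "g \<in> F" "f \<otimes>\<^bsub>G\<^esub> g \<in> F" for f g
    using mult[OF that] \<Theta>_in that F(2) jh hj
    by (auto simp: \<Phi>_def map_monoid_def compose_def fun_eq_iff restrict_def subset_iff)
  moreover have "hamming_dist B (\<Phi> f) \<one>\<^bsub>map_monoid B\<^esub> > 1 - \<epsilon>"
    if f: "f \<in> F" "f \<noteq> \<one>\<^bsub>G\<^esub>" for f
  proof -
    \<comment> \<open>Conjugation by \<open>h\<close> carries moved points to moved points, so the
      numerators of the two distances agree.\<close>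
    have "bij_betw h {a \<in> A. \<Theta> f a \<noteq> a} {b \<in> B. \<Phi> f b \<noteq> b}"
      using jh hj \<Theta>_in[of f] f F(2)
      by (intro bij_betw_byWitness[where f' = j]) (auto simp: \<Phi>_def subset_iff; metis)+
    then have "card {a \<in> A. \<Theta> f a \<noteq> a} = card {b \<in> B. \<Phi> f b \<noteq> b}"
      by (rule bij_betw_same_card)
    moreover have "{a \<in> A. \<Theta> f a \<noteq> (\<one>\<^bsub>map_monoid A\<^esub>) a} = {a \<in> A. \<Theta> f a \<noteq> a}"
      "{b \<in> B. \<Phi> f b \<noteq> (\<one>\<^bsub>map_monoid B\<^esub>) b} = {b \<in> B. \<Phi> f b \<noteq> b}"
      by (auto simp: map_monoid_def)
    ultimately show ?thesis
      using dist[OF f] by (simp add: hamming_dist_def B_def)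
  qed
  moreover have "\<Phi> \<one>\<^bsub>G\<^esub> = \<one>\<^bsub>map_monoid B\<^esub>"
    using jh hj by (auto simp: \<Phi>_def map_monoid_def one)
  moreover have "finite B" "B \<noteq> {}"
    using A by (simp_all add: B_def lessThan_empty_iff)
  ultimately show "\<exists>(A :: nat set) \<Theta>. finite A \<and> A \<noteq> {} \<and>
      \<Theta> \<in> carrier G \<rightarrow> carrier (map_monoid A) \<and>
      (\<forall>f\<in>F. \<forall>g\<in>F. f \<otimes>\<^bsub>G\<^esub> g \<in> F \<longrightarrow>
         \<Theta> (f \<otimes>\<^bsub>G\<^esub> g) = \<Theta> f \<otimes>\<^bsub>map_monoid A\<^esub> \<Theta> g) \<and>
      (\<forall>f\<in>F. f \<noteq> \<one>\<^bsub>G\<^esub> \<longrightarrow> hamming_dist A (\<Theta> f) \<one>\<^bsub>map_monoid A\<^esub> > 1 - \<epsilon>) \<and>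
      \<Theta> \<one>\<^bsub>G\<^esub> = \<one>\<^bsub>map_monoid A\<^esub>"
    by blast
qed

text \<open>A nontrivial self-map of \<open>A\<close> fixes at most \<open>(|A| - 1)\<^sup>L\<close> of the \<open>|A|\<^sup>L\<close> points of \<open>A\<^sup>L\<close>
  under the diagonal action, so separation from the identity can be amplified at will.\<close>

lemma LEF_groupI:
  fixes G :: "('g, 'm) monoid_scheme"
  assumes "group G"
    and approx: "\<And>F. finite F \<Longrightarrow> F \<subseteq> carrier G \<Longrightarrow>
      \<exists>(A :: 'b set) \<Theta>. finite A \<and> A \<noteq> {} \<and> \<Theta> \<in> carrier G \<rightarrow> carrier (map_monoid A) \<and>
        (\<forall>f\<in>F. \<forall>g\<in>F. f \<otimes>\<^bsub>G\<^esub> g \<in> F \<longrightarrow>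
           \<Theta> (f \<otimes>\<^bsub>G\<^esub> g) = \<Theta> f \<otimes>\<^bsub>map_monoid A\<^esub> \<Theta> g) \<and>
        (\<forall>f\<in>F. f \<noteq> \<one>\<^bsub>G\<^esub> \<longrightarrow> \<Theta> f \<noteq> \<one>\<^bsub>map_monoid A\<^esub>) \<and>
        \<Theta> \<one>\<^bsub>G\<^esub> = \<one>\<^bsub>map_monoid A\<^esub>"
  shows "LEF_group G"
proof (rule LEF_groupI_hamming[where 'b = "nat \<Rightarrow> 'b", OF assms(1)])
  fix F :: "'g set" and \<epsilon> :: real
  assume F: "finite F" "F \<subseteq> carrier G" "0 < \<epsilon>"
  obtain A :: "'b set" and \<Theta> where A: "finite A" "A \<noteq> {}"
    and \<Theta>: "\<Theta> \<in> carrier G \<rightarrow> carrier (map_monoid A)"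
    and mult: "\<And>f g. f \<in> F \<Longrightarrow> g \<in> F \<Longrightarrow> f \<otimes>\<^bsub>G\<^esub> g \<in> F \<Longrightarrow>
           \<Theta> (f \<otimes>\<^bsub>G\<^esub> g) = \<Theta> f \<otimes>\<^bsub>map_monoid A\<^esub> \<Theta> g"
    and nontriv: "\<And>f. f \<in> F \<Longrightarrow> f \<noteq> \<one>\<^bsub>G\<^esub> \<Longrightarrow> \<Theta> f \<noteq> \<one>\<^bsub>map_monoid A\<^esub>"
    and one: "\<Theta> \<one>\<^bsub>G\<^esub> = \<one>\<^bsub>map_monoid A\<^esub>"
    using approx[OF F(1,2)] by blast
  \<comment> \<open>The largest proportion of points that a nontrivial self-map of \<open>A\<close>
    can fix. It is below 1, so its powers drop below \<open>\<epsilon>\<close>.\<close>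
  define q where "q = (real (card A) - 1) / real (card A)"
  have cA: "0 < card A" using A by (simp add: card_gt_0_iff)
  have q: "0 \<le> q" "q < 1" using cA by (auto simp: q_def)
  obtain L where L: "q ^ L < \<epsilon>"
    using real_arch_pow_inv[OF F(3) q(2)] by blast
  define B where "B = ({..<L} \<rightarrow>\<^sub>E A)"
  have B: "finite B" "B \<noteq> {}"
    using A by (auto simp: B_def finite_PiE PiE_eq_empty_iff)
  have cB: "card B = card A ^ L" by (simp add: B_def card_PiE)
  define \<Phi> where "\<Phi> f = (\<lambda>b\<in>B. compose {..<L} (\<Theta> f) b)" for f
  have \<Theta>_in: "\<Theta> f a \<in> A" if "f \<in> carrier G" "a \<in> A" for f a
    using \<Theta> that by (auto simp: map_monoid_def Pi_iff)
  have \<Phi>_in: "compose {..<L} (\<Theta> f) b \<in> B" if "f \<in> carrier G" "b \<in> B" for f b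
    using that \<Theta>_in by (auto simp: B_def compose_def)
  have "\<Phi> \<in> carrier G \<rightarrow> carrier (map_monoid B)"
    using \<Phi>_in by (auto simp: \<Phi>_def map_monoid_def)
  moreover have "\<Phi> (f \<otimes>\<^bsub>G\<^esub> g) = \<Phi> f \<otimes>\<^bsub>map_monoid B\<^esub> \<Phi> g"
    if fg: "f \<in> F" "g \<in> F" "f \<otimes>\<^bsub>G\<^esub> g \<in> F" for f g
  proof -
    have "compose {..<L} (compose A (\<Theta> f) (\<Theta> g)) b
        = compose {..<L} (\<Theta> f) (compose {..<L} (\<Theta> g) b)" if "b \<in> B" for b
      using that by (auto simp: compose_def B_def fun_eq_iff PiE_mem)
    then show ?thesis
      using mult[OF fg] \<Phi>_in[of g] fg F(2)
      by (auto simp: \<Phi>_def map_monoid_def compose_def[of B] intro!: restrict_ext)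
  qed
  moreover have "hamming_dist B (\<Phi> f) \<one>\<^bsub>map_monoid B\<^esub> > 1 - \<epsilon>"
    if f: "f \<in> F" "f \<noteq> \<one>\<^bsub>G\<^esub>" for f
  proof -
    define E where "E = {a \<in> A. \<Theta> f a = a}"
    have "\<Theta> f \<in> A \<rightarrow>\<^sub>E A"
      using \<Theta> f F(2) by (auto simp: map_monoid_def)
    moreover have "\<Theta> f \<noteq> (\<lambda>a\<in>A. a)"
      using nontriv[OF f] by (simp add: map_monoid_def)
    ultimately have "E \<noteq> A"
      using PiE_ext[of "\<Theta> f" A "\<lambda>_. A" "\<lambda>a\<in>A. a"] unfolding E_def by fastforce
    then have "card E < card A"
      using A by (intro psubset_card_mono) (auto simp: E_def)
    then have "real (card E) / card A \<le> q"
      using cA by (simp add: q_def field_simps)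
    then have "(real (card E) / card A) ^ L \<le> q ^ L"
      by (intro power_mono) auto
    \<comment> \<open>The action is entrywise, so a tuple is fixed exactly when all its entries lie
      in the fixed set \<open>E\<close>.\<close>
    moreover have "{b \<in> B. \<Phi> f b \<noteq> (\<one>\<^bsub>map_monoid B\<^esub>) b} = B - ({..<L} \<rightarrow>\<^sub>E E)"
    proof -
      have "compose {..<L} (\<Theta> f) b = b \<longleftrightarrow> b \<in> {..<L} \<rightarrow>\<^sub>E E" if "b \<in> B" for b
        using that by (auto simp: B_def E_def compose_def fun_eq_iff PiE_iff extensional_def)
      then show ?thesis
        by (auto simp: \<Phi>_def map_monoid_def)
    qed
    moreover have "({..<L} \<rightarrow>\<^sub>E E) \<subseteq> B"
      by (auto simp: B_def E_def PiE_iff)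
    moreover have "finite ({..<L} \<rightarrow>\<^sub>E E)"
      using A by (auto simp: E_def finite_PiE)
    moreover have "card ({..<L} \<rightarrow>\<^sub>E E) \<le> card B"
      using calculation B by (auto intro: card_mono)
    ultimately have "hamming_dist B (\<Phi> f) \<one>\<^bsub>map_monoid B\<^esub>
        = (real (card A ^ L) - real (card E ^ L)) / real (card A ^ L)"
      unfolding hamming_dist_def by (simp add: card_Diff_subset cB card_PiE of_nat_diff)
    also have "\<dots> = 1 - (real (card E) / card A) ^ L"
      using cA by (simp add: diff_divide_distrib power_divide)
    finally show ?thesis
      using L \<open>(real (card E) / card A) ^ L \<le> q ^ L\<close> by linarith
  qed
  moreover have "\<Phi> \<one>\<^bsub>G\<^esub> = \<one>\<^bsub>map_monoid B\<^esub>"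
  proof -
    have "compose {..<L} (\<lambda>a\<in>A. a) b = b" if "b \<in> B" for b
      using that by (auto simp: B_def compose_def fun_eq_iff PiE_iff extensional_def)
    then show ?thesis
      by (auto simp: \<Phi>_def map_monoid_def one)
  qed
  ultimately show "\<exists>(A :: (nat \<Rightarrow> 'b) set) \<Theta>. finite A \<and> A \<noteq> {} \<and>
      \<Theta> \<in> carrier G \<rightarrow> carrier (map_monoid A) \<and>
      (\<forall>f\<in>F. \<forall>g\<in>F. f \<otimes>\<^bsub>G\<^esub> g \<in> F \<longrightarrow>
         \<Theta> (f \<otimes>\<^bsub>G\<^esub> g) = \<Theta> f \<otimes>\<^bsub>map_monoid A\<^esub> \<Theta> g) \<and>
      (\<forall>f\<in>F. f \<noteq> \<one>\<^bsub>G\<^esub> \<longrightarrow> hamming_dist A (\<Theta> f) \<one>\<^bsub>map_monoid A\<^esub> > 1 - \<epsilon>) \<and>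
      \<Theta> \<one>\<^bsub>G\<^esub> = \<one>\<^bsub>map_monoid A\<^esub>"
    using B by blast
qed

section \<open>Topology of the Cantor space\<close>

lemma cantor_space_Hausdorff:
  assumes "cantor_space X"
  shows "Hausdorff_space X"
  using homeomorphic_Hausdorff_space[OF assms[unfolded cantor_space_def]]
  by (simp add: Hausdorff_space_product_topology)

lemma cantor_space_nonempty:
  assumes "cantor_space X"
  shows "topspace X \<noteq> {}"
proof
  assume "topspace X = {}"
  then have "topspace (product_topology (\<lambda>_::nat. discrete_topology (UNIV :: bool set)) UNIV) = {}"
    using homeomorphic_empty_space[OF assms[unfolded cantor_space_def]]
    by (simp del: topspace_product_topology)
  then show False
    by (simp only: topspace_product_topology PiE_eq_empty_iff) simp
qed

text \<open>A nonempty finite open set in a Hausdorff space contains an isolated point, and the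
  product space has none. Both aperiodicity and infinite recurrence of a minimal homeomorphism rest
  on this.\<close>

lemma cantor_space_infinite_open:
  assumes X: "cantor_space X" and U: "openin X U" "U \<noteq> {}"
  shows "infinite U"
proof
  let ?P = "product_topology (\<lambda>_::nat. discrete_topology (UNIV :: bool set)) UNIV"
  assume "finite U"
  obtain h where h: "homeomorphic_map X ?P h"
    using X by (auto simp: cantor_space_def homeomorphic_space)
  define V where "V = h ` U"
  have V: "openin ?P V" "finite V" "V \<noteq> {}"
    using h U \<open>finite U\<close> homeomorphic_map_openness_eq[OF h] by (auto simp: V_def)
  then obtain x where x: "x \<in> V" by blast
  have "Hausdorff_space ?P" by (simp add: Hausdorff_space_product_topology)
  then have "closedin ?P (V - {x})"
    using V openin_subset[OF V(1)] by (intro closedin_Hausdorff_finite) auto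
  then have "openin ?P (V - (V - {x}))" using V(1) by blast
  moreover have "V - (V - {x}) = {x}" using x by blast
  ultimately have "openin ?P {x}" by simp
  \<comment> \<open>A basic open set restricts only finitely many coordinates, so flipping
    \<open>x\<close> at a free coordinate \<open>i\<close> stays inside it.\<close>
  then obtain W where W: "finite {i. W i \<noteq> UNIV}" "x \<in> Pi\<^sub>E UNIV W" "Pi\<^sub>E UNIV W \<subseteq> {x}"
    by (auto simp: openin_product_topology_alt)
  obtain i where "i \<notin> {i. W i \<noteq> UNIV}"
    using W(1) ex_new_if_finite infinite_UNIV_nat by blast
  then have "x(i := \<not> x i) \<in> Pi\<^sub>E UNIV W" using W(2) by (auto simp: PiE_iff)
  then have "x(i := \<not> x i) = x" using W(3) by blast
  then show False by (metis fun_upd_same)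
qed

section \<open>Pointwise calculus in the homeomorphism group\<close>

lemma carrier_homeo_group:
  "S \<in> carrier (homeo_group X) \<longleftrightarrow> S \<in> Bij (topspace X) \<and> homeomorphic_map X X S"
  by (simp add: homeo_group_def)

lemma homeo_group_closed:
  assumes "f \<in> carrier (homeo_group X)" "x \<in> topspace X"
  shows "f x \<in> topspace X"
  using assms by (auto simp: carrier_homeo_group Bij_def bij_betw_def)

lemma homeo_group_mult_apply:
  assumes "f \<in> carrier (homeo_group X)" "g \<in> carrier (homeo_group X)" "x \<in> topspace X"
  shows "(f \<otimes>\<^bsub>homeo_group X\<^esub> g) x = f (g x)"
  using assms by (simp add: homeo_group_def BijGroup_def compose_def)

lemma homeo_group_one_apply:
  "x \<in> topspace X \<Longrightarrow> (\<one>\<^bsub>homeo_group X\<^esub>) x = x"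
  by (simp add: homeo_group_def BijGroup_def)

lemma homeo_group_inv_apply:
  assumes "f \<in> carrier (homeo_group X)" "x \<in> topspace X"
  shows "(inv\<^bsub>homeo_group X\<^esub> f) (f x) = x" "f ((inv\<^bsub>homeo_group X\<^esub> f) x) = x"
  using homeo_group_mult_apply[of f X "inv\<^bsub>homeo_group X\<^esub> f" x]
    homeo_group_mult_apply[of "inv\<^bsub>homeo_group X\<^esub> f" X f x] assms
    group.inv_closed[OF group_homeo_group] group.l_inv[OF group_homeo_group]
    group.r_inv[OF group_homeo_group] homeo_group_one_apply[of x X]
  by metis+

lemma homeo_group_ext:
  assumes "f \<in> carrier (homeo_group X)" "g \<in> carrier (homeo_group X)"
    and "\<And>x. x \<in> topspace X \<Longrightarrow> f x = g x"
  shows "f = g"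
  using assms by (auto simp: carrier_homeo_group Bij_def intro: extensionalityI)

lemma homeo_group_openin_vimage:
  assumes "f \<in> carrier (homeo_group X)" "openin X U"
  shows "openin X {x \<in> topspace X. f x \<in> U}"
  using assms homeomorphic_imp_continuous_map openin_continuous_map_preimage
  by (fastforce simp: carrier_homeo_group)

lemma homeo_group_openin_image:
  assumes "f \<in> carrier (homeo_group X)" "openin X U"
  shows "openin X (f ` U)"
  using assms homeomorphic_imp_open_map
  by (auto simp: carrier_homeo_group open_map_def)

section \<open>Integer powers and periodic orbits\<close>

locale self_homeo =
  fixes X :: "'a topology" and T :: "'a \<Rightarrow> 'a"
  assumes T_homeo: "T \<in> carrier (homeo_group X)"
begin

abbreviation pw :: "int \<Rightarrow> 'a \<Rightarrow> 'a" where
  "pw n \<equiv> T [^]\<^bsub>homeo_group X\<^esub> n"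

lemma pw_homeo: "pw n \<in> carrier (homeo_group X)"
  using group.int_pow_closed[OF group_homeo_group T_homeo] .

lemma pw_closed: "x \<in> topspace X \<Longrightarrow> pw n x \<in> topspace X"
  using homeo_group_closed[OF pw_homeo] .

lemma pw_0: "x \<in> topspace X \<Longrightarrow> pw 0 x = x"
  by (simp add: int_pow_def2 homeo_group_one_apply)

lemma pw_add: "x \<in> topspace X \<Longrightarrow> pw (m + n) x = pw m (pw n x)"
  using group.int_pow_mult[OF group_homeo_group T_homeo, of m n]
    homeo_group_mult_apply[OF pw_homeo pw_homeo] by metis

text \<open>Every multiple of the period \<open>p\<close> fixes \<open>x\<close>, so
  \<open>pw n x\<close> depends only on \<open>n\<close> modulo
  \<open>\<bar>p\<bar>\<close>.\<close>

lemma finite_orbit: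
  assumes x: "x \<in> topspace X" and p: "pw p x = x" "p \<noteq> 0"
  shows "finite (range (\<lambda>n. pw n x))"
proof -
  have nat_mult: "pw (p * int q) x = x" for q
    by (induction q) (simp_all add: homeo_group_one_apply pw_add x p distrib_left)
  have mult: "pw (p * q) x = x" for q
  proof (cases "0 \<le> q")
    case True
    then show ?thesis using nat_mult[of "nat q"] by simp
  next
    case False
    then have "pw (p * - q) x = x" using nat_mult[of "nat (- q)"] by simp
    then have "pw (p * q) x = pw (p * q) (pw (p * - q) x)" by simp
    also have "\<dots> = x" using x by (simp add: homeo_group_one_apply flip: pw_add)
    finally show ?thesis .
  qed
  have "pw n x = pw (n mod \<bar>p\<bar>) x" for n
  proof -
    \<comment> \<open>Since \<open>p * sgn p\<close> is \<open>\<bar>p\<bar>\<close>, the sign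
      factor covers negative periods.\<close>
    have "n = n mod \<bar>p\<bar> + p * (sgn p * (n div \<bar>p\<bar>))"
      by (simp flip: mult.assoc abs_sgn)
    then show ?thesis using mult pw_add[OF x] by metis
  qed
  moreover have "n mod \<bar>p\<bar> \<in> {0..<\<bar>p\<bar>}" for n using p(2) by simp
  ultimately have "range (\<lambda>n. pw n x) \<subseteq> (\<lambda>n. pw n x) ` {0..<\<bar>p\<bar>}" by blast
  then show ?thesis by (rule finite_subset) simp
qed

end

section \<open>The full group of an aperiodic homeomorphism\<close>

locale aperiodic_homeo = self_homeo +
  assumes aperiodic: "x \<in> topspace X \<Longrightarrow> (T [^]\<^bsub>homeo_group X\<^esub> (n::int)) x = x \<Longrightarrow> n = 0"
begin

lemma pw_inj:
  assumes "x \<in> topspace X" "pw m x = pw n x"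
  shows "m = n"
proof -
  have "pw (m - n) (pw n x) = pw n x"
    using assms by (simp flip: pw_add)
  then show ?thesis
    using aperiodic[OF pw_closed[OF assms(1)]] by fastforce
qed

text \<open>Says that the orbit cocycle of \<open>S\<close> is locally constant and bounded by
  \<open>K\<close>. This replaces the clopen partition: products and inverses can be treated near a
  single point, with no common refinements, and the bound keeps the number of pieces finite.\<close>

definition locally_power :: "int \<Rightarrow> ('a \<Rightarrow> 'a) \<Rightarrow> bool" where
  "locally_power K S \<longleftrightarrow>
     (\<forall>x\<in>topspace X. \<exists>U k. openin X U \<and> x \<in> U \<and> \<bar>k\<bar> \<le> K \<and> (\<forall>z\<in>U. S z = pw k z))"

lemma locally_powerE:
  assumes "locally_power K S" "x \<in> topspace X"
  obtains U k where "openin X U" "x \<in> U" "\<bar>k\<bar> \<le> K" "\<And>z. z \<in> U \<Longrightarrow> S z = pw k z"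
  using assms unfolding locally_power_def by metis

lemma full_group_locally_power:
  assumes "S \<in> carrier (topological_full_group X T)"
  obtains K where "locally_power K S"
proof -
  obtain n :: nat and A :: "nat \<Rightarrow> 'a set" and k :: "nat \<Rightarrow> int" where
    A: "\<And>i. i < n \<Longrightarrow> openin X (A i)" "(\<Union>i<n. A i) = topspace X"
      "\<And>i x. i < n \<Longrightarrow> x \<in> A i \<Longrightarrow> S x = pw (k i) x"
    using assms unfolding topological_full_group_def by clarsimp metis
  have "locally_power (\<Sum>i<n. \<bar>k i\<bar>) S"
    unfolding locally_power_def
  proof
    fix x assume "x \<in> topspace X"
    then obtain i where i: "i < n" "x \<in> A i" using A(2) by blast
    have "\<bar>k i\<bar> \<le> (\<Sum>i<n. \<bar>k i\<bar>)"
      using i(1) by (intro member_le_sum) auto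
    then show "\<exists>U j. openin X U \<and> x \<in> U \<and> \<bar>j\<bar> \<le> (\<Sum>i<n. \<bar>k i\<bar>) \<and> (\<forall>z\<in>U. S z = pw j z)"
      using i A(1,3) by (intro exI[of _ "A i"] exI[of _ "k i"]) simp
  qed
  then show ?thesis by (rule that)
qed

text \<open>Near a point of the level set \<open>S\<close> is one fixed power \<open>pw j\<close>,
  and aperiodicity forces \<open>j = k\<close>.\<close>

lemma locally_power_openin_level:
  assumes "locally_power K S"
  shows "openin X {x \<in> topspace X. S x = pw k x}"
proof (subst openin_subopen, intro ballI)
  fix x assume "x \<in> {x \<in> topspace X. S x = pw k x}"
  then have x: "x \<in> topspace X" "S x = pw k x" by auto
  obtain U j where U: "openin X U" "x \<in> U" "\<And>z. z \<in> U \<Longrightarrow> S z = pw j z"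
    using locally_powerE[OF assms x(1)] by metis
  have "j = k"
    using x U(2,3) pw_inj by metis
  then show "\<exists>V. openin X V \<and> x \<in> V \<and> V \<subseteq> {x \<in> topspace X. S x = pw k x}"
    using U openin_subset by blast
qed

text \<open>The level sets of the exponent form the required partition. They are open, disjoint by
  aperiodicity and finite in number, so each is also closed, being the complement of the union of
  the others.\<close>

lemma locally_power_full_group:
  assumes S: "S \<in> carrier (homeo_group X)" and K: "locally_power K S"
  shows "S \<in> carrier (topological_full_group X T)"
proof -
  define B where "B k = {x \<in> topspace X. S x = pw k x}" for k
  \<comment> \<open>Index \<open>i\<close> stands for the exponent \<open>i - K\<close>, so the
    indices below \<open>n\<close> run through \<open>{-K..K}\<close>.\<close>
  define n where "n = nat (2 * K + 1)"
  define k where "k i = int i - K" for i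
  have cover: "(\<Union>i<n. B (k i)) = topspace X"
  proof
    show "topspace X \<subseteq> (\<Union>i<n. B (k i))"
    proof
      fix x assume x: "x \<in> topspace X"
      obtain j where j: "\<bar>j\<bar> \<le> K" "S x = pw j x"
        using locally_powerE[OF K x] by metis
      have "nat (j + K) < n" "k (nat (j + K)) = j"
        using j(1) by (auto simp: n_def k_def)
      then show "x \<in> (\<Union>i<n. B (k i))"
        using j(2) x by (intro UN_I[of "nat (j + K)"]) (simp_all add: B_def)
    qed
  qed (auto simp: B_def)
  have disj: "i = j" if "x \<in> B (k i)" "x \<in> B (k j)" for i j x
    using that pw_inj[of x "k i" "k j"] by (auto simp: B_def k_def)
  have op: "openin X (B (k i))" for i
    unfolding B_def by (rule locally_power_openin_level[OF K])
  moreover have "closedin X (B (k i))" if "i < n" for i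
  proof -
    have "topspace X - B (k i) = (\<Union>j\<in>{..<n} - {i}. B (k j))"
    proof (intro equalityI subsetI)
      fix x assume "x \<in> topspace X - B (k i)"
      then show "x \<in> (\<Union>j\<in>{..<n} - {i}. B (k j))"
        unfolding cover[symmetric] by blast
    next
      fix x assume "x \<in> (\<Union>j\<in>{..<n} - {i}. B (k j))"
      then obtain j where "j \<noteq> i" "x \<in> B (k j)" by blast
      then show "x \<in> topspace X - B (k i)"
        using disj[of x i j] by (auto simp: B_def)
    qed
    then have "openin X (topspace X - B (k i))"
      using op by auto
    then show ?thesis
      by (auto simp: closedin_def B_def)
  qed
  moreover have "disjoint_family_on (\<lambda>i. B (k i)) {..<n}"
    using disj by (auto simp: disjoint_family_on_def)
  moreover have "\<forall>i<n. \<forall>x\<in>B (k i). S x = pw (k i) x"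
    by (auto simp: B_def)
  ultimately show ?thesis
    using S cover unfolding topological_full_group_def
    by (simp, intro exI[of _ n] exI[of _ "\<lambda>i. B (k i)"] conjI exI[of _ k]) simp_all
qed

lemma full_group_iff:
  "S \<in> carrier (topological_full_group X T) \<longleftrightarrow>
     S \<in> carrier (homeo_group X) \<and> (\<exists>K. locally_power K S)"
proof
  assume S: "S \<in> carrier (topological_full_group X T)"
  then have "S \<in> carrier (homeo_group X)"
    by (simp add: topological_full_group_def)
  then show "S \<in> carrier (homeo_group X) \<and> (\<exists>K. locally_power K S)"
    using full_group_locally_power[OF S] by blast
qed (use locally_power_full_group in blast)

text \<open>Exponents add: that of \<open>g\<close> near \<open>x\<close> and that of
  \<open>f\<close> near \<open>g x\<close>.\<close>

lemma locally_power_mult: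
  assumes f: "f \<in> carrier (homeo_group X)" "locally_power K f"
    and g: "g \<in> carrier (homeo_group X)" "locally_power L g"
  shows "locally_power (K + L) (f \<otimes>\<^bsub>homeo_group X\<^esub> g)"
  unfolding locally_power_def
proof
  fix x assume x: "x \<in> topspace X"
  obtain U k where U: "openin X U" "x \<in> U" "\<bar>k\<bar> \<le> L" "\<And>z. z \<in> U \<Longrightarrow> g z = pw k z"
    using locally_powerE[OF g(2) x] by metis
  obtain V j where V: "openin X V" "g x \<in> V" "\<bar>j\<bar> \<le> K" "\<And>z. z \<in> V \<Longrightarrow> f z = pw j z"
    using locally_powerE[OF f(2) homeo_group_closed[OF g(1) x]] by metis
  define W where "W = U \<inter> {z \<in> topspace X. g z \<in> V}"
  have "(f \<otimes>\<^bsub>homeo_group X\<^esub> g) z = pw (j + k) z" if "z \<in> W" for z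
    using that U(4) V(4) by (simp add: W_def homeo_group_mult_apply[OF f(1) g(1)] pw_add) metis
  moreover have "openin X W" "x \<in> W"
    using U V x homeo_group_openin_vimage[OF g(1)] by (auto simp: W_def)
  moreover have "\<bar>j + k\<bar> \<le> K + L" using U(3) V(3) by linarith
  ultimately show "\<exists>U k. openin X U \<and> x \<in> U \<and> \<bar>k\<bar> \<le> K + L \<and>
      (\<forall>z\<in>U. (f \<otimes>\<^bsub>homeo_group X\<^esub> g) z = pw k z)" by blast
qed

lemma locally_power_inv:
  assumes f: "f \<in> carrier (homeo_group X)" "locally_power K f"
  shows "locally_power K (inv\<^bsub>homeo_group X\<^esub> f)"
  unfolding locally_power_def
proof
  let ?f' = "inv\<^bsub>homeo_group X\<^esub> f"
  fix x assume x: "x \<in> topspace X"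
  have f': "?f' \<in> carrier (homeo_group X)"
    using group.inv_closed[OF group_homeo_group f(1)] .
  obtain U k where U: "openin X U" "?f' x \<in> U" "\<bar>k\<bar> \<le> K" "\<And>z. z \<in> U \<Longrightarrow> f z = pw k z"
    using locally_powerE[OF f(2) homeo_group_closed[OF f' x]] by metis
  have "?f' z = pw (-k) z" if "z \<in> f ` U" for z
  proof -
    obtain u where u: "u \<in> U" "z = f u" using \<open>z \<in> f ` U\<close> by blast
    then have "u \<in> topspace X" using U(1) openin_subset by blast
    then have "?f' z = u" "pw (-k) (pw k u) = u"
      using u homeo_group_inv_apply(1)[OF f(1)]
      by (simp_all add: homeo_group_one_apply flip: pw_add)
    then show ?thesis using u U(4) by simp
  qed
  moreover have "x \<in> f ` U"
    using U(2) homeo_group_inv_apply(2)[OF f(1) x] by force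
  ultimately show "\<exists>U k. openin X U \<and> x \<in> U \<and> \<bar>k\<bar> \<le> K \<and> (\<forall>z\<in>U. ?f' z = pw k z)"
    using homeo_group_openin_image[OF f(1) U(1)] U(3) by (metis abs_minus_cancel)
qed

lemma locally_power_one: "locally_power 0 \<one>\<^bsub>homeo_group X\<^esub>"
  unfolding locally_power_def
  by (auto intro!: exI[of _ "topspace X"] simp: homeo_group_one_apply)

lemma subgroup_full_group:
  "subgroup (carrier (topological_full_group X T)) (homeo_group X)"
proof (rule group.subgroupI[OF group_homeo_group])
  show "carrier (topological_full_group X T) \<noteq> {}"
    using monoid.one_closed[OF group.is_monoid[OF group_homeo_group]] locally_power_one
    by (metis empty_iff full_group_iff)
qed (auto simp: full_group_iff intro: locally_power_mult locally_power_inv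
    group.inv_closed[OF group_homeo_group]
    monoid.m_closed[OF group.is_monoid[OF group_homeo_group]])

lemma group_full_group: "group (topological_full_group X T)"
  using group.subgroup_imp_group[OF group_homeo_group subgroup_full_group]
  by (simp add: topological_full_group_def)

lemma full_group_homeo:
  "f \<in> carrier (topological_full_group X T) \<Longrightarrow> f \<in> carrier (homeo_group X)"
  by (simp add: full_group_iff)

lemma full_group_mult: "f \<otimes>\<^bsub>topological_full_group X T\<^esub> g = f \<otimes>\<^bsub>homeo_group X\<^esub> g"
  and full_group_one: "\<one>\<^bsub>topological_full_group X T\<^esub> = \<one>\<^bsub>homeo_group X\<^esub>"
  by (simp_all add: topological_full_group_def)

section \<open>The action on one orbit, read as a map of the integers\<close>

text \<open>For \<open>y\<close> in the space, at most one \<open>m\<close> qualifies, by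
  \<open>pw_inj\<close>; one exists whenever \<open>f\<close> is locally a power.\<close>

definition pos :: "('a \<Rightarrow> 'a) \<Rightarrow> 'a \<Rightarrow> int \<Rightarrow> int" where
  "pos f y n = (THE m. f (pw n y) = pw m y)"

lemma pos_eqI:
  assumes "y \<in> topspace X" "f (pw n y) = pw m y"
  shows "pos f y n = m"
  unfolding pos_def using assms pw_inj by (intro the_equality) metis+

lemma pos_correct:
  assumes "locally_power K f" "y \<in> topspace X"
  shows "pw (pos f y n) y = f (pw n y)" "\<bar>pos f y n - n\<bar> \<le> K"
proof -
  obtain k where k: "\<bar>k\<bar> \<le> K" "f (pw n y) = pw k (pw n y)"
    using locally_powerE[OF assms(1) pw_closed[OF assms(2)]] by metis
  then have "f (pw n y) = pw (k + n) y" using assms(2) by (simp add: pw_add)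
  moreover from this have "pos f y n = k + n" using assms(2) pos_eqI by blast
  ultimately show "pw (pos f y n) y = f (pw n y)" "\<bar>pos f y n - n\<bar> \<le> K"
    using k by auto
qed

lemma pos_mult:
  assumes f: "f \<in> carrier (topological_full_group X T)"
    and g: "g \<in> carrier (topological_full_group X T)" and y: "y \<in> topspace X"
  shows "pos (f \<otimes>\<^bsub>topological_full_group X T\<^esub> g) y n = pos f y (pos g y n)"
proof -
  obtain K L where "locally_power K f" "locally_power L g"
    using f g by (auto simp: full_group_iff)
  then show ?thesis
    using f g y
    by (intro pos_eqI) (auto simp: full_group_mult homeo_group_mult_apply full_group_homeo
        pw_closed pos_correct)
qed

lemma pos_one: "y \<in> topspace X \<Longrightarrow> pos \<one>\<^bsub>topological_full_group X T\<^esub> y n = n"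
  by (intro pos_eqI) (auto simp: full_group_one homeo_group_one_apply pw_closed)

end

text \<open>The only positions where the reduction modulo \<open>N\<close> matters lie within \<open>R\<close> of the two ends of
  \<open>{0..<N}\<close>, and there \<open>\<phi>\<close> commutes with the translation by \<open>N\<close>.\<close>

lemma mod_comp_eq:
  fixes \<phi> \<psi> :: "int \<Rightarrow> int"
  assumes period: "\<And>n. \<bar>n\<bar> \<le> R \<Longrightarrow> \<phi> (n + N) = \<phi> n + N"
    and \<psi>: "\<bar>\<psi> n - n\<bar> \<le> R" and "R < N" and n: "0 \<le> n" "n < N"
  shows "\<phi> (\<psi> n) mod N = \<phi> (\<psi> n mod N) mod N"
proof -
  consider "\<psi> n < 0" | "0 \<le> \<psi> n" "\<psi> n < N" | "N \<le> \<psi> n" by linarith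
  then show ?thesis
  proof cases
    case 1
    then have "\<psi> n mod N = \<psi> n + N"
      using assms by (intro int_mod_pos_eq[of _ _ "-1"]) auto
    then show ?thesis using period[of "\<psi> n"] 1 \<psi> n by auto
  next
    case 2
    then show ?thesis by simp
  next
    case 3
    then have "\<psi> n mod N = \<psi> n - N"
      using assms by (intro int_mod_pos_eq[of _ _ 1]) auto
    then show ?thesis using period[of "\<psi> n - N"] 3 \<psi> n by auto
  qed
qed

section \<open>Cyclic models from long return times\<close>

text \<open>Minimality enters through \<open>return\<close>: infinitely many visits to an open set
  include one at a time beyond any given bound.\<close>

lemma (in aperiodic_homeo) LEF_full_group:
  assumes nonempty: "topspace X \<noteq> {}"
    and return: "\<And>U x. openin X U \<Longrightarrow> U \<noteq> {} \<Longrightarrow> x \<in> topspace X \<Longrightarrow> infinite {n. pw n x \<in> U}"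
  shows "LEF_group (topological_full_group X T)"
proof (rule LEF_groupI[where 'b = int, OF group_full_group])
  let ?G = "topological_full_group X T"
  fix F assume F: "finite F" "F \<subseteq> carrier ?G"
  obtain x where x: "x \<in> topspace X" using nonempty by blast
  have "\<forall>f\<in>F. \<exists>K. locally_power K f" using F(2) by (auto simp: full_group_iff)
  then obtain K where K: "\<And>f. f \<in> F \<Longrightarrow> locally_power (K f) f" by metis
  have "\<exists>n. f \<noteq> \<one>\<^bsub>?G\<^esub> \<longrightarrow> f (pw n x) \<noteq> pw n x" if f: "f \<in> F" for f
  proof (cases "f = \<one>\<^bsub>?G\<^esub>")
    case False
    have "\<exists>z\<in>topspace X. f z \<noteq> z"
    proof (rule ccontr)
      assume "\<not> ?thesis"
      moreover have "f \<in> carrier (homeo_group X)" using f F(2) full_group_homeo by blast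
      ultimately have "f = \<one>\<^bsub>homeo_group X\<^esub>"
        using monoid.one_closed[OF group.is_monoid[OF group_homeo_group]]
        by (intro homeo_group_ext[of f X]) (simp_all add: homeo_group_one_apply)
      then show False using False by (simp add: full_group_one)
    qed
    then obtain z where z: "z \<in> topspace X" "f z \<noteq> z" by blast
    obtain U k where U: "openin X U" "z \<in> U" "\<And>w. w \<in> U \<Longrightarrow> f w = pw k w"
      using locally_powerE[OF K[OF f] z(1)] by metis
    \<comment> \<open>By aperiodicity a nonzero exponent moves every point of \<open>U\<close>, so
      any visit of the orbit of \<open>x\<close> to \<open>U\<close> shows that \<open>f\<close>
      acts nontrivially on this orbit.\<close>
    have "k \<noteq> 0" using U(2,3) z pw_0 by metis
    have "infinite {n. pw n x \<in> U}" using return U(1,2) x by blast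
    then obtain n where "pw n x \<in> U"
      using not_finite_existsD by blast
    then have "f (pw n x) \<noteq> pw n x"
      using U(3) aperiodic[OF pw_closed[OF x]] \<open>k \<noteq> 0\<close> by metis
    then show ?thesis by blast
  qed auto
  then obtain \<nu> where \<nu>: "\<And>f. f \<in> F \<Longrightarrow> f \<noteq> \<one>\<^bsub>?G\<^esub> \<Longrightarrow> f (pw (\<nu> f) x) \<noteq> pw (\<nu> f) x"
    by metis
  \<comment> \<open>One radius that bounds all displacements and contains all witness positions
    \<open>\<nu> f\<close>. The absolute values make each summand at most the sum.\<close>
  define R where "R = (\<Sum>f\<in>F. \<bar>K f\<bar> + \<bar>\<nu> f\<bar>)"
  have R: "K f \<le> R" "\<bar>\<nu> f\<bar> \<le> R" if "f \<in> F" for f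
  proof -
    have "\<bar>K f\<bar> + \<bar>\<nu> f\<bar> \<le> R"
      unfolding R_def using F(1) that by (intro member_le_sum) auto
    then show "K f \<le> R" "\<bar>\<nu> f\<bar> \<le> R" by auto
  qed
  have "0 \<le> R" by (auto simp: R_def intro: sum_nonneg)
  have "\<forall>f\<in>F. \<forall>n. \<exists>U k. openin X U \<and> pw n x \<in> U \<and> (\<forall>z\<in>U. f z = pw k z)"
    using locally_powerE[OF K pw_closed[OF x]] by metis
  then obtain U k where U: "\<And>f n. f \<in> F \<Longrightarrow> openin X (U f n)" "\<And>f n. f \<in> F \<Longrightarrow> pw n x \<in> U f n"
    "\<And>f n z. f \<in> F \<Longrightarrow> z \<in> U f n \<Longrightarrow> f z = pw (k f n) z" by metis
  define W where "W p = {z \<in> topspace X. pw (snd p) z \<in> U (fst p) (snd p)}" for p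
  \<comment> \<open>On \<open>V\<close> each \<open>f\<close> in \<open>F\<close> has, at every
    position in \<open>{-R..R}\<close>, the same exponent as along the orbit of \<open>x\<close>.
    The factor \<open>topspace X\<close> keeps \<open>V\<close> inside the space when
    \<open>F\<close> is empty.\<close>
  define V where "V = (\<Inter>p\<in>F \<times> {-R..R}. W p) \<inter> topspace X"
  have "openin X (W p)" if "p \<in> F \<times> {-R..R}" for p
    unfolding W_def using that by (intro homeo_group_openin_vimage[OF pw_homeo] U(1)) auto
  then have "openin X V"
    unfolding V_def using F(1) by (intro openin_INT) simp_all
  have "x \<in> V" using x U(2) by (auto simp: V_def W_def)
  have pw_V: "f (pw n z) = pw (k f n + n) z" if "z \<in> V" "f \<in> F" "\<bar>n\<bar> \<le> R" for f n z
  proof -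
    have "z \<in> W (f, n)" using that by (simp add: V_def abs_le_iff)
    then show ?thesis using U(3)[OF \<open>f \<in> F\<close>] by (simp add: W_def pw_add)
  qed
  have "\<not> {n. pw n x \<in> V} \<subseteq> {-R..R}"
    using return[OF \<open>openin X V\<close> _ x] \<open>x \<in> V\<close> finite_subset[OF _ finite_atLeastAtMost_int] by blast
  then obtain n\<^sub>1 where "pw n\<^sub>1 x \<in> V" "n\<^sub>1 \<notin> {-R..R}" by blast
  \<comment> \<open>For a negative return time the segment starts at \<open>pw n\<^sub>1 x\<close>
    and ends at \<open>x\<close>; in both cases \<open>y\<close> and \<open>pw N y\<close> are the
    two points of \<open>V\<close>, in order of time.\<close>
  define y where "y = (if 0 < n\<^sub>1 then x else pw n\<^sub>1 x)"
  define N where "N = \<bar>n\<^sub>1\<bar>"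
  have "R < N" using \<open>n\<^sub>1 \<notin> {-R..R}\<close> by (auto simp: N_def)
  have y: "y \<in> V" "pw N y \<in> V"
    using \<open>x \<in> V\<close> \<open>pw n\<^sub>1 x \<in> V\<close> x by (auto simp: y_def N_def homeo_group_one_apply simp flip: pw_add)
  then have yX: "y \<in> topspace X" by (simp add: V_def)
  have pos_k: "pos f y n = k f n + n" if "f \<in> F" "\<bar>n\<bar> \<le> R" for f n
    using that y(1) yX pw_V by (intro pos_eqI)
  \<comment> \<open>Both \<open>y\<close> and \<open>pw N y\<close> lie in \<open>V\<close>, so the
    exponent at position \<open>n\<close> seen from either is \<open>k f n\<close>.\<close>
  have period: "pos f y (n + N) = pos f y n + N" if "f \<in> F" "\<bar>n\<bar> \<le> R" for f n
    using that y(2) yX pw_V pos_k by (intro pos_eqI) (auto simp: pw_add)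
  have pos_R: "\<bar>pos f y n - n\<bar> \<le> R" if "f \<in> F" for f n
    using pos_correct(2)[OF K[OF that] yX, of n] R(1)[OF that] by linarith
  define A where "A = {0..<N}"
  \<comment> \<open>Reduction modulo \<open>N\<close> lands in \<open>A\<close> for every
    \<open>f\<close>, as the codomain condition demands of the whole group.\<close>
  define \<Theta> where "\<Theta> f = (\<lambda>n\<in>A. pos f y n mod N)" for f
  have mod_A: "n mod N \<in> A" for n
    using \<open>0 \<le> R\<close> \<open>R < N\<close> by (simp add: A_def)
  have "finite A" "A \<noteq> {}" "\<Theta> \<in> carrier ?G \<rightarrow> carrier (map_monoid A)"
    using \<open>0 \<le> R\<close> \<open>R < N\<close> mod_A by (auto simp: A_def \<Theta>_def map_monoid_def)
  moreover have "\<Theta> (f \<otimes>\<^bsub>?G\<^esub> g) = \<Theta> f \<otimes>\<^bsub>map_monoid A\<^esub> \<Theta> g" if "f \<in> F" "g \<in> F" for f g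
  proof -
    have "pos (f \<otimes>\<^bsub>?G\<^esub> g) y n mod N = pos f y (pos g y n mod N) mod N" if "n \<in> A" for n
    proof -
      have "pos (f \<otimes>\<^bsub>?G\<^esub> g) y n = pos f y (pos g y n)"
        using F(2) \<open>f \<in> F\<close> \<open>g \<in> F\<close> yX by (intro pos_mult) auto
      moreover have "pos f y (pos g y n) mod N = pos f y (pos g y n mod N) mod N"
        using that \<open>R < N\<close> period[OF \<open>f \<in> F\<close>] pos_R[OF \<open>g \<in> F\<close>]
        by (intro mod_comp_eq[of R]) (simp_all add: A_def)
      ultimately show ?thesis by simp
    qed
    then show ?thesis
      using mod_A by (auto simp: \<Theta>_def map_monoid_def compose_def intro!: restrict_ext)
  qed
  moreover have "\<Theta> f \<noteq> \<one>\<^bsub>map_monoid A\<^esub>" if f: "f \<in> F" "f \<noteq> \<one>\<^bsub>?G\<^esub>" for f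
  proof
    assume eq: "\<Theta> f = \<one>\<^bsub>map_monoid A\<^esub>"
    define m where "m = \<nu> f mod N"
    \<comment> \<open>The witness \<open>\<nu> f\<close> may be negative; its representative in
      \<open>A\<close> is then \<open>\<nu> f + N\<close>, where \<open>period\<close> gives the
      same image modulo \<open>N\<close>.\<close>
    have "m = \<nu> f \<or> m = \<nu> f + N"
    proof (cases "0 \<le> \<nu> f")
      case True
      then show ?thesis using R(2)[OF f(1)] \<open>R < N\<close> by (auto simp: m_def)
    next
      case False
      then have "m = \<nu> f + N"
        unfolding m_def using R(2)[OF f(1)] \<open>R < N\<close> by (intro int_mod_pos_eq[of _ _ "-1"]) auto
      then show ?thesis ..
    qed
    then have "pos f y m mod N = pos f y (\<nu> f) mod N"
      using period[OF f(1) R(2)[OF f(1)]] by auto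
    moreover have "pos f y m mod N = m"
      using eq mod_A[of "\<nu> f"] unfolding \<Theta>_def map_monoid_def m_def
      by (metis monoid.select_convs(2) restrict_apply')
    ultimately have "pos f y (\<nu> f) mod N = \<nu> f mod N"
      by (simp add: m_def)
    then have "N dvd pos f y (\<nu> f) - \<nu> f"
      by (simp only: mod_eq_dvd_iff)
    \<comment> \<open>A multiple of \<open>N\<close> of absolute value at most \<open>R < N\<close>
      is zero.\<close>
    then have "pos f y (\<nu> f) = \<nu> f"
      using pos_R[OF f(1), of "\<nu> f"] \<open>R < N\<close> zdvd_not_zless[of "\<bar>pos f y (\<nu> f) - \<nu> f\<bar>" N]
      by fastforce
    then have "k f (\<nu> f) = 0"
      using pos_k[OF f(1) R(2)[OF f(1)]] by simp
    \<comment> \<open>The exponent \<open>k f (\<nu> f)\<close> is shared by \<open>y\<close> and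
      \<open>x\<close>, so its vanishing means that \<open>f\<close> fixes
      \<open>pw (\<nu> f) x\<close>, against the choice of \<open>\<nu> f\<close>.\<close>
    then show False
      using pw_V[OF \<open>x \<in> V\<close> f(1) R(2)[OF f(1)]] \<nu>[OF f] by simp
  qed
  moreover have "\<Theta> \<one>\<^bsub>?G\<^esub> = \<one>\<^bsub>map_monoid A\<^esub>"
    using pos_one[OF yX] by (auto simp: \<Theta>_def map_monoid_def A_def intro!: restrict_ext)
  ultimately show "\<exists>(A :: int set) \<Theta>. finite A \<and> A \<noteq> {} \<and> \<Theta> \<in> carrier ?G \<rightarrow> carrier (map_monoid A) \<and>
      (\<forall>f\<in>F. \<forall>g\<in>F. f \<otimes>\<^bsub>?G\<^esub> g \<in> F \<longrightarrow>
         \<Theta> (f \<otimes>\<^bsub>?G\<^esub> g) = \<Theta> f \<otimes>\<^bsub>map_monoid A\<^esub> \<Theta> g) \<and>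
      (\<forall>f\<in>F. f \<noteq> \<one>\<^bsub>?G\<^esub> \<longrightarrow> \<Theta> f \<noteq> \<one>\<^bsub>map_monoid A\<^esub>) \<and>
      \<Theta> \<one>\<^bsub>?G\<^esub> = \<one>\<^bsub>map_monoid A\<^esub>"
    by (intro exI[of _ A] exI[of _ \<Theta>]) blast
qed

section \<open>From minimality to aperiodicity and recurrence\<close>

theorem theorem2:
  fixes C :: "'a topology" and T :: "'a \<Rightarrow> 'a"
  assumes "cantor_space C"
    and "minimal_homeo C T"
  shows "LEF_group (topological_full_group C T)"
proof -
  interpret self_homeo C T
    using assms(2) by unfold_locales (simp add: minimal_homeo_def)
  have dense: "C closure_of (range (\<lambda>n. pw n x)) = topspace C" if "x \<in> topspace C" for x
    using assms(2) that by (simp add: minimal_homeo_def)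
  have closed: "closedin C S" if "finite S" "S \<subseteq> topspace C" for S
    using closedin_Hausdorff_finite[OF cantor_space_Hausdorff[OF assms(1)]] that by blast
  have orbit: "range (\<lambda>n. pw n x) \<subseteq> topspace C" if "x \<in> topspace C" for x
    using pw_closed[OF that] by blast
  interpret aperiodic_homeo C T
  proof
    fix x and n :: int assume x: "x \<in> topspace C" and n: "pw n x = x"
    have "infinite (topspace C)"
      using cantor_space_infinite_open[OF assms(1)] x by blast
    \<comment> \<open>A finite orbit would be closed as well as dense, hence the whole infinite
      space.\<close>
    then have "infinite (range (\<lambda>n. pw n x))"
      using dense[OF x] closed[OF _ orbit[OF x]] by (metis closure_of_closedin)
    then show "n = 0" using finite_orbit[OF x n] by blast
  qed
  show ?thesis
  proof (rule LEF_full_group[OF cantor_space_nonempty[OF assms(1)]])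
    fix U x assume U: "openin C U" "U \<noteq> {}" and x: "x \<in> topspace C"
    show "infinite {n. pw n x \<in> U}"
    proof
      assume fin: "finite {n. pw n x \<in> U}"
      \<comment> \<open>With finitely many visits to \<open>U\<close>, removing the visited points
        leaves an open set, nonempty because \<open>U\<close> is infinite. The dense orbit must meet
        it, at a point of \<open>U\<close> not counted in \<open>S\<close>.\<close>
      define S where "S = (\<lambda>n. pw n x) ` {n. pw n x \<in> U}"
      have S: "finite S" "S \<subseteq> topspace C"
        using fin orbit[OF x] by (auto simp: S_def)
      have "openin C (U - S)" using U(1) closed[OF S] by blast
      moreover obtain z where "z \<in> U - S"
        using cantor_space_infinite_open[OF assms(1) U] S(1)
        by (metis Diff_eq_empty_iff all_not_in_conv finite_subset)
      moreover have "z \<in> C closure_of (range (\<lambda>n. pw n x))"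
        using \<open>z \<in> U - S\<close> openin_subset[OF U(1)] dense[OF x] by blast
      ultimately obtain n where "pw n x \<in> U - S"
        by (auto simp: in_closure_of)
      then show False by (auto simp: S_def)
    qed
  qed
qed

end
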